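(* Given any positive integer $s$ and any integer $r\ge 2s$, there exists a sequence of order-$3$ tensors $B_n$ (all in a common space $\mathbb{R}^{d_1\times d_2\times d_3}$) such that $\operatorname{rank}_\otimes(B_n)\le r$ for all $n$ and $\lim_{n\to\infty}B_n=B$ with $\operatorname{rank}_\otimes(B)=r+s$.
   Context: $\mathbb{R}^{d_1\times d_2\times d_3}\cong\mathbb{R}^{d_1}\otimes\mathbb{R}^{d_2}\otimes\mathbb{R}^{d_3}$ is the space of real 3-way arrays, with its norm topology; $\mathbf{x}\otimes\mathbf{y}\otimes\mathbf{z}$ is the array with entries $x_iy_jz_k$ (a decomposable tensor). The outer-product rank $\operatorname{rank}_{\otimes}(A)$ is the least $r\ge 0$ such that $A$ is a sum of $r$ decomposable tensors. *)

theory Defs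
  imports "HOL-Analysis.Analysis"
begin

text \<open>The dimensions are existentially quantified in the theorem, so they are natural numbers
  and not index types: vectors and 3-way arrays are functions on \<^typ>\<open>nat\<close> indices
  (counted from 0) that vanish outside the index range.\<close>

type_synonym array3 = "nat \<Rightarrow> nat \<Rightarrow> nat \<Rightarrow> real"

definition vec_space :: "nat \<Rightarrow> (nat \<Rightarrow> real) set" where
  "vec_space d = {x. \<forall>i. d \<le> i \<longrightarrow> x i = 0}"

definition array_space :: "nat \<Rightarrow> nat \<Rightarrow> nat \<Rightarrow> array3 set" where
  "array_space d1 d2 d3 =
     {A. \<forall>i j k. \<not> (i < d1 \<and> j < d2 \<and> k < d3) \<longrightarrow> A i j k = 0}"

definition outer :: "(nat \<Rightarrow> real) \<Rightarrow> (nat \<Rightarrow> real) \<Rightarrow> (nat \<Rightarrow> real) \<Rightarrow> array3" where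
  "outer x y z = (\<lambda>i j k. x i * y j * z k)"

definition decomposables :: "nat \<Rightarrow> nat \<Rightarrow> nat \<Rightarrow> array3 set" where
  "decomposables d1 d2 d3 =
     {outer x y z | x y z. x \<in> vec_space d1 \<and> y \<in> vec_space d2 \<and> z \<in> vec_space d3}"

definition sum_of_decomposables :: "nat \<Rightarrow> nat \<Rightarrow> nat \<Rightarrow> nat \<Rightarrow> array3 \<Rightarrow> bool" where
  "sum_of_decomposables d1 d2 d3 r A \<longleftrightarrow>
     (\<exists>T. (\<forall>l<r. T l \<in> decomposables d1 d2 d3) \<and> A = (\<lambda>i j k. \<Sum>l<r. T l i j k))"

text \<open>Only meaningful on \<^term>\<open>array_space d1 d2 d3\<close>, where the minimum exists by
  the lemma \<open>array_space_sum_of_decomposables\<close> below.\<close>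

definition outer_rank :: "nat \<Rightarrow> nat \<Rightarrow> nat \<Rightarrow> array3 \<Rightarrow> nat" where
  "outer_rank d1 d2 d3 A = (LEAST r. sum_of_decomposables d1 d2 d3 r A)"

definition array_norm :: "nat \<Rightarrow> nat \<Rightarrow> nat \<Rightarrow> array3 \<Rightarrow> real" where
  "array_norm d1 d2 d3 A =
     L2_set (\<lambda>(i, j, k). A i j k) ({..<d1} \<times> {..<d2} \<times> {..<d3})"

definition array_tendsto :: "nat \<Rightarrow> nat \<Rightarrow> nat \<Rightarrow> (nat \<Rightarrow> array3) \<Rightarrow> array3 \<Rightarrow> bool" where
  "array_tendsto d1 d2 d3 B L \<longleftrightarrow>
     (\<lambda>n. array_norm d1 d2 d3 (\<lambda>i j k. B n i j k - L i j k)) \<longlonglongrightarrow> 0"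

lemma array_space_sum_of_decomposables:
  assumes A: "A \<in> array_space d1 d2 d3"
  shows "\<exists>r. sum_of_decomposables d1 d2 d3 r A"
proof -
  let ?I = "{..<d1} \<times> {..<d2} \<times> {..<d3}"
  define e :: "nat \<Rightarrow> nat \<Rightarrow> real" where "e = (\<lambda>a i. if i = a then 1 else 0)"
  define S where "S = (\<lambda>(a, b, c). outer (\<lambda>i. A a b c * e a i) (e b) (e c))"
  obtain h where h: "bij_betw h {..<card ?I} ?I"
    using ex_bij_betw_nat_finite[of ?I] by (auto simp: atLeast0LessThan)
  have S: "S p \<in> decomposables d1 d2 d3" if pI: "p \<in> ?I" for p
  proof -
    obtain a b c where p: "p = (a, b, c)" "a < d1" "b < d2" "c < d3"
      using pI by blast
    have "(\<lambda>i. A a b c * e a i) \<in> vec_space d1" "e b \<in> vec_space d2" "e c \<in> vec_space d3"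
      using p by (auto simp: vec_space_def e_def)
    then show ?thesis
      unfolding decomposables_def S_def p(1) by auto
  qed
  have eq: "(\<Sum>l<card ?I. S (h l) i j k) = A i j k" for i j k
  proof -
    have "(\<Sum>l<card ?I. S (h l) i j k) = (\<Sum>p\<in>?I. S p i j k)"
      by (rule sum.reindex_bij_betw[OF h])
    also have "\<dots> = (\<Sum>p\<in>?I. if p = (i, j, k) then A i j k else 0)"
      by (rule sum.cong) (auto simp: S_def outer_def e_def split: if_splits)
    also have "\<dots> = A i j k"
      using A by (auto simp: array_space_def)
    finally show ?thesis .
  qed
  have "sum_of_decomposables d1 d2 d3 (card ?I) A"
    unfolding sum_of_decomposables_def
  proof (intro exI[of _ "\<lambda>l. S (h l)"] conjI allI impI)
    show "S (h l) \<in> decomposables d1 d2 d3" if l: "l < card ?I" for l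
      using S bij_betw_apply[OF h] l by blast
    show "A = (\<lambda>i j k. \<Sum>l<card ?I. S (h l) i j k)"
      by (intro ext) (rule eq[symmetric])
  qed
  then show ?thesis ..
qed

end

theory Submission
  imports Defs
begin

text \<open>The limit is a direct sum of \<open>s\<close> copies of
  \<open>x \<otimes> x \<otimes> y + x \<otimes> y \<otimes> x + y \<otimes> x \<otimes> x\<close>, the derivative at \<open>h = 0\<close> of \<open>(x + h y)\<^sup>\<otimes>\<^sup>3\<close>, and of
  \<open>r - 2 s\<close> cubes of basis vectors. Difference quotients of \<open>(x + h y)\<^sup>\<otimes>\<^sup>3\<close> have rank at most 2, which
  gives the approximating sequence. For the lower bound (substitution), suppose that the limit is a
  sum of \<open>m\<close> decomposable tensors \<open>a \<otimes> b \<otimes> c\<close>. Its contraction with a vector \<open>u\<close> along the third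
  index is the direct sum of the matrices with rows \<open>(q, p)\<close>, \<open>(p, 0)\<close> and of a diagonal matrix. This
  matrix is invertible as soon as all \<open>p\<close> and the diagonal entries are 1, whatever the \<open>s\<close>
  entries \<open>q\<close>; these can be chosen such that \<open>s\<close> of the \<open>m\<close> linear forms \<open>c\<close> vanish at \<open>u\<close>. So an
  invertible matrix of size \<open>r\<close> is a sum of \<open>m - s\<close> matrices of rank at most 1, and \<open>r \<le> m - s\<close>.\<close>

section \<open>Linear systems\<close>

text \<open>Gaussian elimination, by induction on \<open>K\<close>: forms without a common nonzero
  zero include one with a nonzero coefficient at \<open>k0\<close>, which serves as pivot to
  eliminate \<open>k0\<close> from the others. Solvability for every \<open>g\<close> expresses the
  independence of the forms in \<open>S\<close>.\<close>

lemma injective_forms_solvable_subsystem: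
  fixes c :: "'i \<Rightarrow> 'k \<Rightarrow> 'a::field"
  assumes "finite K" "finite I"
    and "\<And>q. (\<And>l. l \<in> I \<Longrightarrow> (\<Sum>k\<in>K. c l k * q k) = 0) \<Longrightarrow> \<forall>k\<in>K. q k = 0"
  shows "\<exists>S\<subseteq>I. card S = card K \<and> (\<forall>g. \<exists>q. \<forall>l\<in>S. (\<Sum>k\<in>K. c l k * q k) = g l)"
  using assms
proof (induction K arbitrary: I c rule: finite_induct)
  case empty
  then show ?case by (intro exI[of _ "{}"]) auto
next
  case (insert k0 K)
  have "\<exists>l0\<in>I. c l0 k0 \<noteq> 0"
  proof (rule ccontr)
    assume z: "\<not> (\<exists>l0\<in>I. c l0 k0 \<noteq> 0)"
    have "\<forall>k\<in>insert k0 K. (if k = k0 then 1 else 0 :: 'a) = 0"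
      by (rule insert.prems(2)) (use z insert.hyps in \<open>auto intro!: sum.neutral\<close>)
    then show False by simp
  qed
  then obtain l0 where l0: "l0 \<in> I" "c l0 k0 \<noteq> 0" by blast
  define c' where "c' l k = c l k - c l k0 * c l0 k / c l0 k0" for l k
  define f where "f l q = (\<Sum>k\<in>K. c l k * q k)" for l and q :: "'k \<Rightarrow> 'a"
  have c': "(\<Sum>k\<in>K. c' l k * q k) = f l q - c l k0 * f l0 q / c l0 k0" for l q
    by (simp add: c'_def f_def left_diff_distrib sum_subtractf sum_distrib_left sum_divide_distrib
        mult.assoc)
  have upd: "(\<Sum>k\<in>insert k0 K. c l k * (q(k0 := z)) k) = c l k0 * z + f l q" for l q z
    using insert.hyps by (auto simp: f_def intro!: sum.cong)
  have "\<exists>S\<subseteq>I - {l0}. card S = card K \<and> (\<forall>g. \<exists>q. \<forall>l\<in>S. (\<Sum>k\<in>K. c' l k * q k) = g l)"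
  proof (rule insert.IH)
    fix q assume q: "\<And>l. l \<in> I - {l0} \<Longrightarrow> (\<Sum>k\<in>K. c' l k * q k) = 0"
    \<comment> \<open>At this value for \<open>k0\<close> the pivot form vanishes and every other
      form takes the value of its reduced form at \<open>q\<close>.\<close>
    have "\<forall>k\<in>insert k0 K. (q(k0 := - f l0 q / c l0 k0)) k = 0"
    proof (rule insert.prems(2))
      fix l assume "l \<in> I"
      then show "(\<Sum>k\<in>insert k0 K. c l k * (q(k0 := - f l0 q / c l0 k0)) k) = 0"
        using q[of l] l0(2) unfolding upd c' by (cases "l = l0") auto
    qed
    then show "\<forall>k\<in>K. q k = 0" using insert.hyps by (auto split: if_splits)
  qed (use insert.prems in auto)
  then obtain S where S: "S \<subseteq> I - {l0}" "card S = card K"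
    and sol: "\<And>g. \<exists>q. \<forall>l\<in>S. (\<Sum>k\<in>K. c' l k * q k) = g l" by blast
  show ?case
  proof (intro exI[of _ "insert l0 S"] conjI allI)
    have "finite S" using S(1) insert.prems(1) finite_subset by blast
    then show "card (insert l0 S) = card (insert k0 K)"
      using S insert.hyps by (auto simp: card_insert_if)
    fix g
    \<comment> \<open>The right-hand sides undergo the same elimination as the forms; the value at
      \<open>k0\<close> then comes from the pivot equation.\<close>
    obtain q where q: "\<forall>l\<in>S. (\<Sum>k\<in>K. c' l k * q k) = g l - c l k0 * g l0 / c l0 k0"
      using sol[of "\<lambda>l. g l - c l k0 * g l0 / c l0 k0"] by blast
    show "\<exists>q. \<forall>l\<in>insert l0 S. (\<Sum>k\<in>insert k0 K. c l k * q k) = g l"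
    proof (intro exI ballI)
      fix l assume "l \<in> insert l0 S"
      then show "(\<Sum>k\<in>insert k0 K. c l k * (q(k0 := (g l0 - f l0 q) / c l0 k0)) k) = g l"
        using q l0(2) unfolding upd c' by (auto simp: diff_divide_distrib algebra_simps)
    qed
  qed (use S l0 in auto)
qed

corollary injective_forms_card_le:
  fixes c :: "'i \<Rightarrow> 'k \<Rightarrow> 'a::field"
  assumes "finite K" "finite I"
    and "\<And>q. (\<And>l. l \<in> I \<Longrightarrow> (\<Sum>k\<in>K. c l k * q k) = 0) \<Longrightarrow> \<forall>k\<in>K. q k = 0"
  shows "card K \<le> card I"
  using injective_forms_solvable_subsystem[OF assms] assms(2) card_mono by metis

section \<open>Sums of decomposable tensors\<close>

lemma sum_of_decomposables_outer:
  assumes "x \<in> vec_space d1" "y \<in> vec_space d2" "z \<in> vec_space d3"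
  shows "sum_of_decomposables d1 d2 d3 1 (outer x y z)"
  unfolding sum_of_decomposables_def decomposables_def using assms
  by (intro exI[of _ "\<lambda>_. outer x y z"]) auto

lemma sum_of_decomposables_add:
  assumes "sum_of_decomposables d1 d2 d3 m A" "sum_of_decomposables d1 d2 d3 n B"
  shows "sum_of_decomposables d1 d2 d3 (m + n) (\<lambda>i j k. A i j k + B i j k)"
proof -
  obtain S T where S: "\<forall>l<m. S l \<in> decomposables d1 d2 d3" "A = (\<lambda>i j k. \<Sum>l<m. S l i j k)"
    and T: "\<forall>l<n. T l \<in> decomposables d1 d2 d3" "B = (\<lambda>i j k. \<Sum>l<n. T l i j k)"
    using assms unfolding sum_of_decomposables_def by auto
  define U where "U l = (if l < m then S l else T (l - m))" for l
  have "(\<Sum>l<m + n. U l i j k) = (\<Sum>l<m. S l i j k) + (\<Sum>l<n. T l i j k)" for i j k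
    by (induction n) (auto simp: U_def)
  moreover have "\<forall>l<m + n. U l \<in> decomposables d1 d2 d3" using S T by (auto simp: U_def)
  ultimately show ?thesis
    unfolding sum_of_decomposables_def S(2) T(2) by (intro exI[of _ U]) auto
qed

lemma sum_of_decomposables_sum:
  assumes "\<And>l. l < n \<Longrightarrow> sum_of_decomposables d1 d2 d3 p (A l)"
  shows "sum_of_decomposables d1 d2 d3 (n * p) (\<lambda>i j k. \<Sum>l<n. A l i j k)"
  using assms
proof (induction n)
  case 0
  then show ?case by (simp add: sum_of_decomposables_def)
next
  case (Suc n)
  then have "sum_of_decomposables d1 d2 d3 (n * p + p) (\<lambda>i j k. (\<Sum>l<n. A l i j k) + A n i j k)"
    by (intro sum_of_decomposables_add) auto
  then show ?case by (simp add: add.commute)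
qed

lemma sum_of_decomposables_in_array_space:
  assumes "sum_of_decomposables d1 d2 d3 m A"
  shows "A \<in> array_space d1 d2 d3"
proof -
  obtain T where T: "\<forall>l<m. T l \<in> decomposables d1 d2 d3" "A = (\<lambda>i j k. \<Sum>l<m. T l i j k)"
    using assms unfolding sum_of_decomposables_def by auto
  have "T l i j k = 0" if "l < m" "\<not> (i < d1 \<and> j < d2 \<and> k < d3)" for l i j k
  proof -
    obtain x y z where "T l = outer x y z"
      "x \<in> vec_space d1" "y \<in> vec_space d2" "z \<in> vec_space d3"
      using T(1) \<open>l < m\<close> unfolding decomposables_def by blast
    then show ?thesis using that(2) by (auto simp: outer_def vec_space_def not_less)
  qed
  then show ?thesis unfolding T(2) by (simp add: array_space_def)
qed

lemma outer_rank_le: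
  "sum_of_decomposables d1 d2 d3 m A \<Longrightarrow> outer_rank d1 d2 d3 A \<le> m"
  unfolding outer_rank_def by (rule Least_le)

lemma array_tendsto_entrywise:
  assumes "\<And>i j k. (\<lambda>n. B n i j k) \<longlonglongrightarrow> L i j k"
  shows "array_tendsto d1 d2 d3 B L"
proof -
  have "(\<lambda>n. sqrt (\<Sum>(i, j, k)\<in>{..<d1} \<times> {..<d2} \<times> {..<d3}. (B n i j k - L i j k)\<^sup>2))
      \<longlonglongrightarrow> sqrt (\<Sum>(i, j, k)\<in>{..<d1} \<times> {..<d2} \<times> {..<d3}. (L i j k - L i j k)\<^sup>2)"
    unfolding split_beta by (intro tendsto_intros assms)
  then show ?thesis by (simp add: array_tendsto_def array_norm_def L2_set_def split_beta)
qed

section \<open>The limit tensor and its approximations\<close>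

definition unit_vec :: "nat \<Rightarrow> nat \<Rightarrow> real" where
  "unit_vec a i = (if i = a then 1 else 0)"

text \<open>The block with index \<open>l < s\<close> has \<open>x = unit_vec l\<close> and \<open>y = unit_vec (s + l)\<close>.\<close>

definition limit_tensor :: "nat \<Rightarrow> nat \<Rightarrow> array3" where
  "limit_tensor s t = (\<lambda>i j k.
     (\<Sum>l<s. outer (unit_vec l) (unit_vec l) (unit_vec (s + l)) i j k
           + outer (unit_vec l) (unit_vec (s + l)) (unit_vec l) i j k
           + outer (unit_vec (s + l)) (unit_vec l) (unit_vec l) i j k)
   + (\<Sum>l<t. outer (unit_vec (2 * s + l)) (unit_vec (2 * s + l)) (unit_vec (2 * s + l)) i j k))"

text \<open>Each block is the difference quotient of the cube, with the factor \<open>1 / h\<close>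
  absorbed into the first vectors, so that it consists of two decomposable tensors.\<close>

definition approx_tensor :: "nat \<Rightarrow> nat \<Rightarrow> real \<Rightarrow> array3" where
  "approx_tensor s t h = (\<lambda>i j k.
     (\<Sum>l<s. outer (\<lambda>i. (unit_vec l i + h * unit_vec (s + l) i) / h)
             (\<lambda>i. unit_vec l i + h * unit_vec (s + l) i)
             (\<lambda>i. unit_vec l i + h * unit_vec (s + l) i) i j k
           + outer (\<lambda>i. - unit_vec l i / h) (unit_vec l) (unit_vec l) i j k)
   + (\<Sum>l<t. outer (unit_vec (2 * s + l)) (unit_vec (2 * s + l)) (unit_vec (2 * s + l)) i j k))"

lemma unit_vec_in_vec_space: "a < d \<Longrightarrow> unit_vec a \<in> vec_space d"
  by (simp add: vec_space_def unit_vec_def)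

lemma limit_tensor_decomposables:
  "sum_of_decomposables (2 * s + t) (2 * s + t) (2 * s + t) (3 * s + t) (limit_tensor s t)"
proof -
  let ?D = "sum_of_decomposables (2 * s + t) (2 * s + t) (2 * s + t)"
  have "?D (s * (1 + 1 + 1) + t * 1) (limit_tensor s t)"
    unfolding limit_tensor_def
    by (intro sum_of_decomposables_add sum_of_decomposables_sum sum_of_decomposables_outer
        unit_vec_in_vec_space) auto
  moreover have "s * (1 + 1 + 1) + t * 1 = 3 * s + t" by simp
  ultimately show ?thesis by (simp only:)
qed

lemma approx_tensor_decomposables:
  "sum_of_decomposables (2 * s + t) (2 * s + t) (2 * s + t) (2 * s + t) (approx_tensor s t h)"
proof -
  let ?D = "sum_of_decomposables (2 * s + t) (2 * s + t) (2 * s + t)"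
  have "?D (s * (1 + 1) + t * 1) (approx_tensor s t h)"
    unfolding approx_tensor_def
    by (intro sum_of_decomposables_add sum_of_decomposables_sum sum_of_decomposables_outer)
      (auto simp: vec_space_def unit_vec_def)
  moreover have "s * (1 + 1) + t * 1 = 2 * s + t" by simp
  ultimately show ?thesis by (simp only:)
qed

text \<open>The terms \<open>x * y * z / h\<close> cancel, which leaves a polynomial in
  \<open>h\<close> whose constant term is the limit.\<close>

lemma difference_quotient_cube_tendsto:
  fixes x x' y y' z z' :: real
  shows "((\<lambda>h. (x + h * x') / h * (y + h * y') * (z + h * z') + - x / h * y * z)
    \<longlongrightarrow> x * y * z' + x * y' * z + x' * y * z) (at 0)"
proof (rule Lim_transform_eventually)
  show "((\<lambda>h. x * y * z' + x * y' * z + x' * y * z + h * (x * y' * z' + x' * y * z' + x' * y' * z)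
      + h\<^sup>2 * x' * y' * z') \<longlongrightarrow> x * y * z' + x * y' * z + x' * y * z) (at 0)"
    by (auto intro!: tendsto_eq_intros)
  show "\<forall>\<^sub>F h in at 0. x * y * z' + x * y' * z + x' * y * z
      + h * (x * y' * z' + x' * y * z' + x' * y' * z) + h\<^sup>2 * x' * y' * z'
    = (x + h * x') / h * (y + h * y') * (z + h * z') + - x / h * y * z"
    by (auto simp: eventually_at_filter field_simps power2_eq_square)
qed

lemma approx_tensor_tendsto:
  "((\<lambda>h. approx_tensor s t h i j k) \<longlongrightarrow> limit_tensor s t i j k) (at 0)"
  unfolding approx_tensor_def limit_tensor_def outer_def
  by (intro tendsto_add tendsto_sum difference_quotient_cube_tendsto tendsto_const)

section \<open>The lower bound\<close>

text \<open>The matrix that results from contraction with \<open>u\<close>, applied to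
  \<open>v\<close>; its invertibility becomes triviality of a kernel.\<close>

definition contract :: "nat \<Rightarrow> array3 \<Rightarrow> (nat \<Rightarrow> real) \<Rightarrow> (nat \<Rightarrow> real) \<Rightarrow> nat \<Rightarrow> real" where
  "contract d A v u i = (\<Sum>j<d. \<Sum>k<d. A i j k * v j * u k)"

lemma contract_outer:
  "contract d (outer x y z) v u i = x i * (\<Sum>j<d. y j * v j) * (\<Sum>k<d. z k * u k)"
  unfolding contract_def outer_def mult.assoc[of "x i"] sum_product
  by (simp add: sum_distrib_left mult_ac)

lemma contract_add:
  "contract d (\<lambda>i j k. A i j k + B i j k) v u i = contract d A v u i + contract d B v u i"
  by (simp add: contract_def sum.distrib distrib_right)

lemma contract_sum:
  fixes n :: nat
  shows "contract d (\<lambda>i j k. \<Sum>l<n. A l i j k) v u i = (\<Sum>l<n. contract d (A l) v u i)"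
  by (induction n) (simp_all add: contract_add, simp add: contract_def)

lemma sum_unit_vec: "a < d \<Longrightarrow> (\<Sum>j<d. unit_vec a j * v j) = v a"
  by (simp add: unit_vec_def if_distrib[of "\<lambda>x. x * _"] cong: if_cong)

lemma contract_limit_tensor:
  "contract (2 * s + t) (limit_tensor s t) v u i =
     (\<Sum>l<s. unit_vec l i * (v l * u (s + l) + v (s + l) * u l) + unit_vec (s + l) i * (v l * u l))
   + (\<Sum>l<t. unit_vec (2 * s + l) i * (v (2 * s + l) * u (2 * s + l)))"
  unfolding limit_tensor_def contract_add contract_sum contract_outer
  by (intro arg_cong2[where f = "(+)"] sum.cong) (auto simp: sum_unit_vec distrib_left)

text \<open>With \<open>p = u l\<close> and \<open>q = u (s + l)\<close>, the first two rows are the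
  block \<open>(q, p)\<close>, \<open>(p, 0)\<close> acting on \<open>(v l, v (s + l))\<close>; the
  third is the diagonal part.\<close>

lemma contract_limit_tensor_rows:
  shows "l < s \<Longrightarrow> contract (2 * s + t) (limit_tensor s t) v u l = v l * u (s + l) + v (s + l) * u l"
    and "l < s \<Longrightarrow> contract (2 * s + t) (limit_tensor s t) v u (s + l) = v l * u l"
    and "l < t \<Longrightarrow> contract (2 * s + t) (limit_tensor s t) v u (2 * s + l)
      = v (2 * s + l) * u (2 * s + l)"
  unfolding contract_limit_tensor
  by (simp_all add: unit_vec_def sum.distrib if_distrib[of "\<lambda>x. x * _"] cong: if_cong)

lemma limit_tensor_decomposables_ge:
  assumes "sum_of_decomposables (2 * s + t) (2 * s + t) (2 * s + t) m (limit_tensor s t)"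
  shows "3 * s + t \<le> m"
proof -
  define d where "d = 2 * s + t"
  obtain T where T: "\<forall>l<m. T l \<in> decomposables d d d"
    "limit_tensor s t = (\<lambda>i j k. \<Sum>l<m. T l i j k)"
    using assms unfolding sum_of_decomposables_def d_def by auto
  have "\<forall>l. \<exists>a b c. l < m \<longrightarrow> T l = outer a b c"
    using T(1) unfolding decomposables_def by blast
  then obtain a b c where abc: "\<And>l. l < m \<Longrightarrow> T l = outer (a l) (b l) (c l)"
    by metis
  have contr: "contract d (limit_tensor s t) v u i
      = (\<Sum>l<m. a l i * (\<Sum>j<d. b l j * v j) * (\<Sum>k<d. c l k * u k))" for v u i
    unfolding T(2) contract_sum by (intro sum.cong refl) (simp add: abc contract_outer)
  \<comment> \<open>These are the coordinates of \<open>u\<close> that become the free entries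
    \<open>q\<close> of the blocks.\<close>
  define K where "K = {s..<2 * s}"
  \<comment> \<open>The constant value \<open>e\<close> outside \<open>K\<close> is 0 in the proof
    of injectivity and 1 for the final \<open>u\<close>.\<close>
  have split: "(\<Sum>k<d. c l k * (if k \<in> K then q k else e))
      = (\<Sum>k\<in>K. c l k * q k) + e * (\<Sum>k\<in>{..<d} - K. c l k)" for l q e
  proof -
    have "K \<subseteq> {..<d}" by (auto simp: K_def d_def)
    then show ?thesis
      by (subst sum.subset_diff[of K]) (auto simp: sum_distrib_left intro!: sum.cong)
  qed
  have "\<exists>S\<subseteq>{..<m}. card S = card K \<and> (\<forall>g. \<exists>q. \<forall>l\<in>S. (\<Sum>k\<in>K. c l k * q k) = g l)"
  proof (rule injective_forms_solvable_subsystem)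
    fix q assume q: "\<And>l. l \<in> {..<m} \<Longrightarrow> (\<Sum>k\<in>K. c l k * q k) = 0"
    \<comment> \<open>If all forms vanish at \<open>q\<close>, extended by zero, then so does the
      contraction. For \<open>v\<close> constantly 1, its row \<open>k - s\<close> is
      \<open>u k + u (k - s)\<close>, and \<open>k - s\<close> lies outside
      \<open>K\<close>.\<close>
    define u where "u k = (if k \<in> K then q k else 0)" for k
    have "(\<Sum>k<d. c l k * u k) = 0" if "l < m" for l
      using split[of l q 0] q[of l] that by (simp add: u_def)
    then have z: "contract d (limit_tensor s t) (\<lambda>_. 1) u i = 0" for i
      unfolding contr by simp
    show "\<forall>k\<in>K. q k = 0"
    proof
      fix k assume k: "k \<in> K"
      then have "u k + u (k - s) = 0"
        using z[of "k - s"] contract_limit_tensor_rows(1)[of "k - s" s t "\<lambda>_. 1" u]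
        unfolding d_def by (auto simp: K_def)
      then show "q k = 0" using k by (auto simp: u_def K_def split: if_splits)
    qed
  qed (auto simp: K_def)
  then obtain S where S: "S \<subseteq> {..<m}" "card S = s"
    and sol: "\<And>g. \<exists>q. \<forall>l\<in>S. (\<Sum>k\<in>K. c l k * q k) = g l" by (auto simp: K_def)
  \<comment> \<open>The right-hand side cancels the contribution of the ones outside
    \<open>K\<close>, so the forms in \<open>S\<close> vanish at the \<open>u\<close> below.\<close>
  obtain q where q: "\<forall>l\<in>S. (\<Sum>k\<in>K. c l k * q k) = - (\<Sum>k\<in>{..<d} - K. c l k)"
    using sol[of "\<lambda>l. - (\<Sum>k\<in>{..<d} - K. c l k)"] by blast
  define u where "u k = (if k \<in> K then q k else 1)" for k
  have u0: "(\<Sum>k<d. c l k * u k) = 0" if "l \<in> S" for l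
    using split[of l q 1] q that by (simp add: u_def)
  have u1: "u k = 1" if "k < s \<or> 2 * s \<le> k" for k using that by (auto simp: u_def K_def)
  have "card {..<d} \<le> card ({..<m} - S)"
  proof (rule injective_forms_card_le)
    fix v assume v: "\<And>l. l \<in> {..<m} - S \<Longrightarrow> (\<Sum>j\<in>{..<d}. b l j * v j) = 0"
    have z: "contract d (limit_tensor s t) v u i = 0" for i
      unfolding contr
    proof (intro sum.neutral ballI)
      fix l assume "l \<in> {..<m}"
      then show "a l i * (\<Sum>j<d. b l j * v j) * (\<Sum>k<d. c l k * u k) = 0"
        using v[of l] u0[of l] by (cases "l \<in> S") auto
    qed
    \<comment> \<open>Row \<open>s + l\<close> comes first: once \<open>v l = 0\<close>, the unknown
      entry \<open>u (s + l)\<close> drops out of row \<open>l\<close>.\<close>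
    have v0: "v l = 0" if "l < s" for l
      using z[of "s + l"] contract_limit_tensor_rows(2)[of l s t v u] u1[of l] that
      by (simp add: d_def)
    have v1: "v (s + l) = 0" if "l < s" for l
      using z[of l] contract_limit_tensor_rows(1)[of l s t v u] u1[of l] v0[of l] that
      by (simp add: d_def)
    have v2: "v (2 * s + l) = 0" if "l < t" for l
      using z[of "2 * s + l"] contract_limit_tensor_rows(3)[of l t s v u] u1[of "2 * s + l"] that
      by (simp add: d_def)
    show "\<forall>k\<in>{..<d}. v k = 0"
    proof
      fix k assume "k \<in> {..<d}"
      then consider "k < s" | "s \<le> k" "k - s < s" | "2 * s \<le> k" "k - 2 * s < t"
        unfolding d_def by fastforce
      then show "v k = 0" using v0[of k] v1[of "k - s"] v2[of "k - 2 * s"] by cases auto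
    qed
  qed auto
  moreover have "s \<le> m" using card_mono[OF _ S(1)] S(2) by simp
  moreover have "card ({..<m} - S) = m - s"
    using S card_Diff_subset[of S "{..<m}"] finite_subset by auto
  ultimately show ?thesis by (simp add: d_def)
qed

theorem proposition4p11:
  fixes r s :: nat
  assumes "s \<ge> 1" and "r \<ge> 2 * s"
  shows "\<exists>(d1::nat) (d2::nat) (d3::nat) (B :: nat \<Rightarrow> array3) (L :: array3).
           (\<forall>n. B n \<in> array_space d1 d2 d3) \<and> L \<in> array_space d1 d2 d3 \<and>
           (\<forall>n. outer_rank d1 d2 d3 (B n) \<le> r) \<and>
           array_tendsto d1 d2 d3 B L \<and>
           outer_rank d1 d2 d3 L = r + s"
proof -
  define t where "t = r - 2 * s"
  have r: "r = 2 * s + t" "r + s = 3 * s + t" using assms by (auto simp: t_def)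
  note approx = approx_tensor_decomposables[of s t, folded r]
    and limit = limit_tensor_decomposables[of s t, folded r]
  \<comment> \<open>The parameter tends to 0 without ever being 0, as the limit along
    \<open>at 0\<close> requires.\<close>
  define B where "B n = approx_tensor s t (inverse (real (Suc n)))" for n
  have at_0: "filterlim (\<lambda>n. inverse (real (Suc n))) (at 0) sequentially"
    using LIMSEQ_inverse_real_of_nat by (auto simp: filterlim_at)
  have "array_tendsto r r r B (limit_tensor s t)"
    unfolding B_def
    by (intro array_tendsto_entrywise filterlim_compose[OF approx_tensor_tendsto at_0])
  moreover have "outer_rank r r r (limit_tensor s t) = r + s"
    unfolding outer_rank_def
    by (intro Least_equality limit limit_tensor_decomposables_ge[of s t, folded r])
  ultimately show ?thesis
    using approx limit
    by (intro exI[of _ r] exI[of _ B] exI[of _ "limit_tensor s t"])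
      (auto simp: B_def intro: sum_of_decomposables_in_array_space outer_rank_le)
qed

end
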